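(* Let $\{\phi_i\}_{i=1}^M$ be a unit norm frame for $\mathbb{H}^N$ with $M<\dim\mathrm{sym}(\mathbb{H}^{N\times N})$, and let $T$ be its analysis operator. If $\{\phi_i\phi_i^*\}_{i=1}^M$ is linearly independent, then the set of vectors $\phi_{M+1}\in S_{N-1}$ for which $\{\phi_i\phi_i^*\}_{i=1}^{M+1}$ is a dependent set of outer products is exactly $$T^{-1}\left(\mu^2_{\{\phi_i\}_{i=1}^M}\cap\mu^4_{\{\phi_i\}_{i=1}^M}\right),$$ and this set is compact in the Euclidean topology.
   Context: $\mathbb{H}$ denotes $\mathbb{R}$ or $\mathbb{C}$, with $\langle\phi,\psi\rangle=\sum_i\phi(i)\overline{\psi(i)}$. $\mathrm{sym}(\mathbb{H}^{N\times N})$ is the real vector space of self-adjoint $N\times N$ matrices over $\mathbb{H}$ (dimension $N(N+1)/2$ for $\mathbb{R}$, $N^2$ for $\mathbb{C}$). A frame for $\mathbb{H}^N$ is a finite spanning sequence; unit norm means $\|\phi_i\|=1$ for all $i$. $S_{N-1}$ is the unit sphere of $\mathbb{H}^N$. The analysis operator is $T:\mathbb{H}^N\to\mathbb{H}^M$, $T\psi=(\langle\psi,\phi_i\rangle)_{i=1}^M$; it is injective, and $T^{-1}$ denotes the inverse of the bijection $T|_{S_{N-1}}:S_{N-1}\to TS_{N-1}$. Dependence of $\{\phi_i\phi_i^*\}_{i=1}^{M+1}$ is understood as linear dependence of the indexed family. Define $\mu^2_{\{\phi_i\}_{i=1}^M}:=T S_{N-1}\subset\mathbb{H}^M$ (an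 ellipsoid). Let $G_{op}=[|\langle\phi_i,\phi_j\rangle|^2]_{i,j=1}^M$ be the Gram matrix of $\{\phi_i\phi_i^*\}_{i=1}^M$ (in the Frobenius inner product), let $\{e_i'\}_{i=1}^M$ be an orthonormal basis of $\mathbb{H}^M$ of eigenvectors of $G_{op}$ with eigenvalues $\{\lambda_i'\}_{i=1}^M$ (all positive since the outer products are independent). With $v\circ\overline v$ denoting the entrywise product of $v$ with its complex conjugate, define $$\mu^4_{\{\phi_i\}_{i=1}^M}:=\left\{v\in\mathbb{H}^M:\ \sum_{i=1}^M\frac{|\langle v\circ\overline v,e_i'\rangle|^2}{\lambda_i'}=1\right\}.$$ *)

theory Defs
  imports "HOL-Analysis.Analysis"
begin

text \<open>
  The scalar field, real or complex, is a type class, so that \<open>'a ^ 'n\<close> covers both cases at once.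
  The axiom \<open>real_or_complex\<close> leaves only these two models up to isomorphism: the reals with
  trivial conjugation, or the reals with a square root \<open>j\<close> of \<open>- 1\<close> adjoined and the
  conjugation sending \<open>j\<close> to \<open>- j\<close>.
\<close>

class rc_field = real_normed_field + euclidean_space +
  fixes conj :: "'a \<Rightarrow> 'a"
  assumes real_or_complex:
    "(\<forall>x. \<exists>a. x = a *\<^sub>R 1 \<and> conj x = a *\<^sub>R 1) \<or>
     (\<exists>j. j * j = - 1 \<and>
        (\<forall>x. \<exists>a b. x = a *\<^sub>R 1 + b *\<^sub>R j \<and> conj x = a *\<^sub>R 1 - b *\<^sub>R j))"
  and mult_conj: "x * conj x = (norm x)\<^sup>2 *\<^sub>R 1"

instantiation real :: rc_field
begin
definition conj_real :: "real \<Rightarrow> real" where "conj_real x = x"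
instance by standard (auto simp: conj_real_def power2_eq_square)
end

instantiation complex :: rc_field
begin
definition conj_complex :: "complex \<Rightarrow> complex" where "conj_complex = cnj"
instance
proof
  have "\<exists>a b. x = a *\<^sub>R 1 + b *\<^sub>R \<i> \<and> conj x = a *\<^sub>R 1 - b *\<^sub>R \<i>" for x :: complex
    by (rule exI[of _ "Re x"], rule exI[of _ "Im x"]) (simp add: conj_complex_def complex_eq_iff)
  then show "(\<forall>x::complex. \<exists>a. x = a *\<^sub>R 1 \<and> conj x = a *\<^sub>R 1) \<or>
     (\<exists>j::complex. j * j = - 1 \<and>
        (\<forall>x. \<exists>a b. x = a *\<^sub>R 1 + b *\<^sub>R j \<and> conj x = a *\<^sub>R 1 - b *\<^sub>R j))"
    by (intro disjI2 exI[of _ "\<i>"]) simp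
  show "x * conj x = (norm x)\<^sup>2 *\<^sub>R 1" for x :: complex
    by (simp add: conj_complex_def complex_norm_square[symmetric] scaleR_conv_of_real del: of_real_power)
qed
end

definition hinner :: "'a::rc_field ^ 'n \<Rightarrow> 'a ^ 'n \<Rightarrow> 'a" where
  "hinner x y = (\<Sum>i\<in>UNIV. x $ i * conj (y $ i))"

definition outer :: "'a::rc_field ^ 'n \<Rightarrow> 'a ^ 'n ^ 'n" where
  "outer x = (\<chi> i j. x $ i * conj (x $ j))"

definition self_adjoint_matrices :: "('a::rc_field ^ 'n ^ 'n) set" where
  "self_adjoint_matrices = {A. \<forall>i j. A $ i $ j = conj (A $ j $ i)}"

text \<open>
  Linear dependence of an indexed family over the reals, the scalars of the space of
  self-adjoint matrices; a family with a repeated member is dependent.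
\<close>

definition dependent_family :: "('i::finite \<Rightarrow> 'v::real_vector) \<Rightarrow> bool" where
  "dependent_family F \<longleftrightarrow> (\<exists>c. (\<exists>i. c i \<noteq> 0) \<and> (\<Sum>i\<in>UNIV. c i *\<^sub>R F i) = 0)"

text \<open>
  The constant \<open>vec.span\<close> is the span over the scalar field \<open>'a\<close>, whereas \<open>span\<close> is the real span.
\<close>

definition unit_norm_frame :: "('m::finite \<Rightarrow> 'a::rc_field ^ 'n) \<Rightarrow> bool" where
  "unit_norm_frame \<phi> \<longleftrightarrow> vec.span (range \<phi>) = UNIV \<and> (\<forall>i. norm (\<phi> i) = 1)"

definition analysis_op :: "('m::finite \<Rightarrow> 'a::rc_field ^ 'n) \<Rightarrow> 'a ^ 'n \<Rightarrow> 'a ^ 'm" where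
  "analysis_op \<phi> \<psi> = (\<chi> i. hinner \<psi> (\<phi> i))"

definition gram_op :: "('m::finite \<Rightarrow> 'a::rc_field ^ 'n) \<Rightarrow> 'a ^ 'm ^ 'm" where
  "gram_op \<phi> = (\<chi> i j. of_real ((norm (hinner (\<phi> i) (\<phi> j)))\<^sup>2))"

definition orthonormal_basis :: "('m::finite \<Rightarrow> 'a::rc_field ^ 'm) \<Rightarrow> bool" where
  "orthonormal_basis e \<longleftrightarrow>
     (\<forall>i j. hinner (e i) (e j) = (if i = j then 1 else 0)) \<and> vec.span (range e) = UNIV"

definition mu2 :: "('m::finite \<Rightarrow> 'a::rc_field ^ 'n) \<Rightarrow> ('a ^ 'm) set" where
  "mu2 \<phi> = analysis_op \<phi> ` sphere 0 1"

text \<open>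
  The set \<open>mu4\<close> depends on the frame through an orthonormal eigenbasis \<open>e\<close> of \<open>gram_op \<phi>\<close> with
  eigenvalues \<open>l\<close>.
\<close>

definition mu4 :: "('m::finite \<Rightarrow> 'a::rc_field ^ 'm) \<Rightarrow> ('m \<Rightarrow> real) \<Rightarrow> ('a ^ 'm) set" where
  "mu4 e l = {v. (\<Sum>i\<in>UNIV. (norm (hinner (\<chi> k. v $ k * conj (v $ k)) (e i)))\<^sup>2 / l i) = 1}"

end

theory Submission
  imports Defs
begin

text \<open>
  In the real inner product space of matrices, the outer products satisfy
  \<open>\<langle>\<psi>\<psi>*, \<phi>\<phi>*\<rangle> = |\<langle>\<psi>, \<phi>\<rangle>|\<^sup>2\<close> (\<open>inner_outer\<close>). Let \<open>V\<close> be the span of the independent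
  matrices \<open>\<phi>\<^sub>i\<phi>\<^sub>i*\<close>. Adding \<open>\<psi>\<psi>*\<close> to them makes a dependent family exactly when
  \<open>\<psi>\<psi>*\<close> lies in \<open>V\<close> (\<open>dependent_family_case_option_iff\<close>), that is, when the orthogonal
  projection of the unit vector \<open>\<psi>\<psi>*\<close> to \<open>V\<close> still has norm 1.

  Write this projection as \<open>\<Sum> c\<^sub>i \<phi>\<^sub>i\<phi>\<^sub>i*\<close>. Taking inner products with the \<open>\<phi>\<^sub>i\<phi>\<^sub>i*\<close> gives the
  normal equations \<open>G c = b\<close>, where \<open>G\<close> is the Gram matrix and
  \<open>b\<^sub>i = |\<langle>\<psi>, \<phi>\<^sub>i\<rangle>|\<^sup>2\<close>, so that \<open>b\<close> is the entrywise product of \<open>T \<psi>\<close> with its conjugate. The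
  squared norm of the projection is \<open>\<langle>b, c\<rangle>\<close>, and expanding it in an orthonormal eigenbasis of
  \<open>G\<close> turns it into the quadratic form that defines \<open>\<mu>\<^sup>4\<close>
  (\<open>eigenbasis_quadratic_form\<close>). Hence a unit vector \<open>\<psi>\<close> is in the set if and only if
  \<open>T \<psi> \<in> \<mu>\<^sup>4\<close> (\<open>analysis_op_mem_mu4_iff\<close>). As \<open>T\<close> is injective, this is the claimed
  preimage. The set is compact because it consists of the points of the unit sphere that the
  continuous map \<open>\<psi> \<mapsto> \<psi>\<psi>*\<close> sends into the closed subspace \<open>V\<close>.
\<close>

section \<open>Conjugation in the scalar field\<close>

text \<open>
  If \<open>u = w * j\<close> with \<open>u\<close> and \<open>w\<close> real, then squaring gives \<open>u\<^sup>2 = - w\<^sup>2\<close> in the reals.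
\<close>

lemma real_imag_parts_unique:
  fixes j :: "'a::rc_field"
  assumes j: "j * j = - 1" and eq: "a *\<^sub>R 1 + b *\<^sub>R j = c *\<^sub>R 1 + d *\<^sub>R j"
  shows "a = c \<and> b = d"
proof -
  have "(a - c) *\<^sub>R (1::'a) = (d - b) *\<^sub>R j"
    using eq by (simp add: algebra_simps)
  then have "((a - c) *\<^sub>R (1::'a)) * ((a - c) *\<^sub>R 1) = ((d - b) *\<^sub>R j) * ((d - b) *\<^sub>R j)"
    by simp
  then have "((a - c) * (a - c)) *\<^sub>R (1::'a) = (- ((d - b) * (d - b))) *\<^sub>R 1"
    by (simp add: j)
  then have "(a - c) * (a - c) + (d - b) * (d - b) = 0"
    unfolding scaleR_cancel_right by simp
  then show ?thesis
    by (simp add: sum_squares_eq_zero_iff)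
qed

text \<open>
  The axiom only says that each element has some decomposition from which its conjugate can be
  read off; uniqueness makes the decompositions of \<open>x\<close>, \<open>y\<close> and \<open>x + y\<close> fit together.
\<close>

lemma conj_add: "conj (x + y) = conj x + conj (y::'a::rc_field)"
  using real_or_complex[where ?'a = 'a]
proof
  assume "\<forall>x::'a. \<exists>a. x = a *\<^sub>R 1 \<and> conj x = a *\<^sub>R 1"
  then have "conj z = z" for z :: 'a by metis
  then show ?thesis by simp
next
  assume "\<exists>j::'a. j * j = - 1 \<and> (\<forall>x. \<exists>a b. x = a *\<^sub>R 1 + b *\<^sub>R j \<and> conj x = a *\<^sub>R 1 - b *\<^sub>R j)"
  then obtain j :: 'a where j: "j * j = - 1"
    and ex: "\<And>x. \<exists>a b. x = a *\<^sub>R 1 + b *\<^sub>R j \<and> conj x = a *\<^sub>R 1 - b *\<^sub>R j" by blast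
  obtain a b where x: "x = a *\<^sub>R 1 + b *\<^sub>R j" "conj x = a *\<^sub>R 1 - b *\<^sub>R j" using ex by blast
  obtain c d where y: "y = c *\<^sub>R 1 + d *\<^sub>R j" "conj y = c *\<^sub>R 1 - d *\<^sub>R j" using ex by blast
  obtain p q where xy: "x + y = p *\<^sub>R 1 + q *\<^sub>R j" "conj (x + y) = p *\<^sub>R 1 - q *\<^sub>R j"
    using ex by blast
  have "(a + c) *\<^sub>R 1 + (b + d) *\<^sub>R j = p *\<^sub>R 1 + q *\<^sub>R j"
    using x(1) y(1) xy(1) by (simp add: algebra_simps)
  then have "p = a + c" "q = b + d"
    using real_imag_parts_unique[OF j] by blast+
  then show ?thesis
    unfolding x(2) y(2) xy(2) by (simp add: algebra_simps)
qed

lemma conj_zero [simp]: "conj (0::'a::rc_field) = 0"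
  using conj_add[of "0::'a" 0] by simp

lemma mult_conj_of_real: "x * conj (x::'a::rc_field) = of_real ((norm x)\<^sup>2)"
  by (simp only: mult_conj of_real_def)

text \<open>
  Away from 0, \<open>mult_conj\<close> determines the conjugate as \<open>|x|\<^sup>2 / x\<close>, and this expression is
  multiplicative.
\<close>

lemma conj_eq_divide: "x \<noteq> 0 \<Longrightarrow> conj (x::'a::rc_field) = of_real ((norm x)\<^sup>2) / x"
  using mult_conj_of_real[of x] by (simp add: field_simps)

lemma conj_mult: "conj (x * y) = conj x * conj (y::'a::rc_field)"
proof (cases "x = 0 \<or> y = 0")
  case False
  then show ?thesis
    by (simp add: conj_eq_divide norm_mult power_mult_distrib)
qed auto

lemma conj_of_real [simp]: "conj (of_real a :: 'a::rc_field) = of_real a"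
proof (cases "a = 0")
  case False
  then show ?thesis
    by (simp add: conj_eq_divide power2_eq_square)
qed auto

lemma norm_conj [simp]: "norm (conj (x::'a::rc_field)) = norm x"
  by (cases "x = 0") (simp_all add: conj_eq_divide norm_divide norm_mult power2_eq_square)

lemma conj_conj [simp]: "conj (conj (x::'a::rc_field)) = x"
proof (cases "x = 0")
  case False
  then have "conj x \<noteq> 0"
    by (metis norm_conj norm_eq_zero)
  moreover have "conj x * conj (conj x) = conj x * x"
    by (metis mult_conj_of_real norm_conj mult.commute)
  ultimately show ?thesis by simp
qed simp

lemma conj_scaleR: "conj (a *\<^sub>R (x::'a::rc_field)) = a *\<^sub>R conj x"
  by (simp add: scaleR_conv_of_real conj_mult)

lemma linear_conj: "linear (conj :: 'a::rc_field \<Rightarrow> 'a)"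
  by (rule linearI) (simp_all add: conj_add conj_scaleR)

lemma conj_sum: "conj (\<Sum>i\<in>A. f i :: 'a::rc_field) = (\<Sum>i\<in>A. conj (f i))"
  by (rule linear_sum[OF linear_conj])

text \<open>The real inner product of the scalar field is the real part of \<open>x * conj y\<close>.\<close>

lemma of_real_inner:
  "of_real (2 * inner x y) = x * conj y + conj (x * conj y)" for x y :: "'a::rc_field"
proof -
  have "2 * inner x y = (norm (x + y))\<^sup>2 - (norm x)\<^sup>2 - (norm y)\<^sup>2"
    by (simp add: power2_norm_eq_inner inner_add inner_commute)
  then have "of_real (2 * inner x y) = (x + y) * conj (x + y) - x * conj x - y * conj y"
    by (simp only: mult_conj_of_real of_real_diff)
  then show ?thesis
    by (simp add: conj_add conj_mult algebra_simps)
qed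

section \<open>The scalar-valued inner product\<close>

lemma hinner_add_left: "hinner (x + y) z = hinner x z + hinner y z"
  by (simp add: hinner_def algebra_simps sum.distrib)

lemma hinner_scale_left: "hinner (c *s x) z = c * hinner x z"
  by (simp add: hinner_def sum_distrib_left mult.assoc)

lemma hinner_zero_left [simp]: "hinner 0 z = 0"
  by (simp add: hinner_def)

lemma hinner_diff_left: "hinner (x - y) z = hinner x z - hinner y z"
  by (simp add: hinner_def algebra_simps sum_subtractf)

lemma hinner_sum_left: "hinner (\<Sum>i\<in>A. f i) z = (\<Sum>i\<in>A. hinner (f i) z)"
  by (induction A rule: infinite_finite_induct) (simp_all add: hinner_add_left)

lemma conj_hinner: "conj (hinner x y) = hinner y x"
  by (simp add: hinner_def conj_sum conj_mult mult.commute)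

lemma hinner_self: "hinner x x = of_real ((norm x)\<^sup>2)"
proof -
  have "(norm x)\<^sup>2 = (\<Sum>i\<in>UNIV. (norm (x $ i))\<^sup>2)"
    by (simp add: norm_vec_def L2_set_def sum_nonneg)
  then show ?thesis
    by (simp only: hinner_def mult_conj_of_real of_real_sum)
qed

text \<open>
  The vectors orthogonal to a given one form a subspace, so a vector orthogonal to a spanning set
  is orthogonal to itself. This yields both the injectivity of the analysis operator and
  Parseval's identity.
\<close>

lemma orthogonal_to_spanning_eq_0:
  fixes x :: "'a::rc_field ^ 'n"
  assumes span: "vec.span (range b) = UNIV" and orth: "\<And>i. hinner x (b i) = 0"
  shows "x = 0"
proof -
  have orth': "hinner (b i) x = 0" for i
    by (metis conj_hinner orth conj_zero)
  have "vec.subspace {y. hinner y x = 0}"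
    by (rule vec.subspaceI) (simp_all add: hinner_add_left hinner_scale_left)
  then have "vec.span (range b) \<subseteq> {y. hinner y x = 0}"
    using orth' by (intro vec.span_minimal) auto
  then have "hinner x x = 0"
    using span by blast
  then show ?thesis
    by (simp add: hinner_self)
qed

lemma inj_analysis_op:
  assumes "unit_norm_frame \<phi>"
  shows "inj (analysis_op \<phi>)"
proof (rule injI)
  fix x y assume "analysis_op \<phi> x = analysis_op \<phi> y"
  then have "hinner (x - y) (\<phi> i) = 0" for i
    by (simp add: analysis_op_def vec_eq_iff hinner_diff_left)
  with assms have "x - y = 0"
    unfolding unit_norm_frame_def by (blast intro: orthogonal_to_spanning_eq_0)
  then show "x = y" by simp
qed

lemma orthonormal_expansion:
  assumes "orthonormal_basis e"
  shows "x = (\<Sum>i\<in>UNIV. hinner x (e i) *s e i)"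
proof -
  have "hinner (x - (\<Sum>i\<in>UNIV. hinner x (e i) *s e i)) (e k) = 0" for k
    using assms
    by (simp add: orthonormal_basis_def hinner_diff_left hinner_sum_left hinner_scale_left
        if_distrib[of "(*) _"] cong: if_cong)
  then have "x - (\<Sum>i\<in>UNIV. hinner x (e i) *s e i) = 0"
    using assms unfolding orthonormal_basis_def by (blast intro: orthogonal_to_spanning_eq_0)
  then show ?thesis by simp
qed

lemma parseval:
  assumes "orthonormal_basis e"
  shows "hinner x y = (\<Sum>i\<in>UNIV. hinner x (e i) * conj (hinner y (e i)))"
  by (subst (1) orthonormal_expansion[OF assms, of x])
     (simp add: hinner_sum_left hinner_scale_left conj_hinner)

section \<open>Outer products and linear dependence\<close>

text \<open>
  Summing over both indices, \<open>x\<^sub>i conj(x\<^sub>j) conj(y\<^sub>i conj(y\<^sub>j))\<close> factors as \<open>\<langle>x, y\<rangle>\<close> times its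
  conjugate.
\<close>

lemma inner_outer: "inner (outer x) (outer y) = (norm (hinner x y))\<^sup>2"
  for x y :: "'a::rc_field ^ 'n"
proof -
  have eq: "(\<Sum>i\<in>UNIV. \<Sum>j\<in>UNIV. outer x $ i $ j * conj (outer y $ i $ j)) =
      hinner x y * conj (hinner x y)"
    unfolding hinner_def conj_sum sum_product
    by (simp add: outer_def conj_mult algebra_simps)
  have "(of_real (2 * inner (outer x) (outer y)) :: 'a) =
      (\<Sum>i\<in>UNIV. \<Sum>j\<in>UNIV. of_real (2 * inner (outer x $ i $ j) (outer y $ i $ j)))"
    by (simp add: inner_vec_def sum_distrib_left)
  also have "\<dots> = hinner x y * conj (hinner x y) + conj (hinner x y * conj (hinner x y))"
    unfolding of_real_inner sum.distrib eq[symmetric] conj_sum ..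
  also have "\<dots> = of_real (2 * (norm (hinner x y))\<^sup>2)"
    unfolding mult_conj_of_real conj_of_real by simp
  finally show ?thesis
    unfolding of_real_eq_iff by simp
qed

lemma continuous_on_outer: "continuous_on S (outer :: 'a::rc_field ^ 'n \<Rightarrow> _)"
  unfolding outer_def
  by (intro continuous_intros linear_continuous_on_compose[OF _ linear_conj])

lemma span_range_eq_sums:
  fixes F :: "'i::finite \<Rightarrow> 'v::real_vector"
  shows "span (range F) = range (\<lambda>c. \<Sum>i\<in>UNIV. c i *\<^sub>R F i)"
proof
  have "subspace (range (\<lambda>c. \<Sum>i\<in>UNIV. c i *\<^sub>R F i))"
  proof (rule subspaceI)
    show "0 \<in> range (\<lambda>c. \<Sum>i\<in>UNIV. c i *\<^sub>R F i)"
      by (rule range_eqI[of _ _ "\<lambda>_. 0"]) simp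
  next
    fix x y
    assume "x \<in> range (\<lambda>c. \<Sum>i\<in>UNIV. c i *\<^sub>R F i)" "y \<in> range (\<lambda>c. \<Sum>i\<in>UNIV. c i *\<^sub>R F i)"
    then obtain c d where "x = (\<Sum>i\<in>UNIV. c i *\<^sub>R F i)" "y = (\<Sum>i\<in>UNIV. d i *\<^sub>R F i)" by blast
    then show "x + y \<in> range (\<lambda>c. \<Sum>i\<in>UNIV. c i *\<^sub>R F i)"
      by (intro range_eqI[of _ _ "\<lambda>i. c i + d i"]) (simp add: scaleR_left_distrib sum.distrib)
  next
    fix a x assume "x \<in> range (\<lambda>c. \<Sum>i\<in>UNIV. c i *\<^sub>R F i)"
    then obtain c where "x = (\<Sum>i\<in>UNIV. c i *\<^sub>R F i)" by blast
    then show "a *\<^sub>R x \<in> range (\<lambda>c. \<Sum>i\<in>UNIV. c i *\<^sub>R F i)"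
      by (intro range_eqI[of _ _ "\<lambda>i. a * c i"]) (simp add: scaleR_sum_right)
  qed
  moreover have "F k \<in> range (\<lambda>c. \<Sum>i\<in>UNIV. c i *\<^sub>R F i)" for k
    by (rule range_eqI[of _ _ "\<lambda>i. if i = k then 1 else 0"])
       (simp add: if_distrib[of "\<lambda>r. r *\<^sub>R _"] cong: if_cong)
  ultimately show "span (range F) \<subseteq> range (\<lambda>c. \<Sum>i\<in>UNIV. c i *\<^sub>R F i)"
    by (intro span_minimal) auto
  show "range (\<lambda>c. \<Sum>i\<in>UNIV. c i *\<^sub>R F i) \<subseteq> span (range F)"
    by (blast intro: span_sum span_scale span_base)
qed

text \<open>
  Because \<open>F\<close> is independent, \<open>x\<close> has a nonzero coefficient in every nontrivial relation of the
  extended family, so the relation can be solved for \<open>x\<close>.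
\<close>

lemma dependent_family_case_option_iff:
  fixes F :: "'i::finite \<Rightarrow> 'v::real_vector"
  assumes indep: "\<not> dependent_family F"
  shows "dependent_family (case_option x F) \<longleftrightarrow> x \<in> span (range F)"
proof -
  have sum_option:
    "(\<Sum>i\<in>UNIV. c i *\<^sub>R case_option x F i) = c None *\<^sub>R x + (\<Sum>i\<in>UNIV. c (Some i) *\<^sub>R F i)"
    for c :: "'i option \<Rightarrow> real"
    by (simp add: UNIV_option_conv sum.reindex)
  show ?thesis
  proof
    assume "dependent_family (case_option x F)"
    then obtain c i where ci: "c i \<noteq> 0"
      and eq: "c None *\<^sub>R x + (\<Sum>i\<in>UNIV. c (Some i) *\<^sub>R F i) = 0"
      unfolding dependent_family_def sum_option by blast
    have nz: "c None \<noteq> 0"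
    proof
      assume z: "c None = 0"
      with ci obtain k where "c (Some k) \<noteq> 0" by (cases i) auto
      moreover have "(\<Sum>i\<in>UNIV. c (Some i) *\<^sub>R F i) = 0" using eq z by simp
      ultimately show False
        using indep unfolding dependent_family_def by meson
    qed
    have "c None *\<^sub>R x = - (\<Sum>i\<in>UNIV. c (Some i) *\<^sub>R F i)"
      using eq by (simp add: eq_neg_iff_add_eq_0)
    also have "\<dots> \<in> span (range F)"
      by (intro span_neg span_sum span_scale span_base) auto
    finally have "(1 / c None) *\<^sub>R (c None *\<^sub>R x) \<in> span (range F)"
      by (rule span_scale)
    then show "x \<in> span (range F)" using nz by simp
  next
    assume "x \<in> span (range F)"
    then obtain c where "x = (\<Sum>i\<in>UNIV. c i *\<^sub>R F i)"
      unfolding span_range_eq_sums by blast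
    then show "dependent_family (case_option x F)"
      unfolding dependent_family_def sum_option
      by (intro exI[of _ "case_option (-1) c"]) (auto intro!: exI[of _ None])
  qed
qed

section \<open>The quadratic form of the Gram matrix\<close>

lemma hinner_gram_op_selfadjoint: "hinner (gram_op \<phi> *v x) y = hinner x (gram_op \<phi> *v y)"
proof -
  have sym: "norm (hinner (\<phi> i) (\<phi> j)) = norm (hinner (\<phi> j) (\<phi> i))" for i j
    by (metis conj_hinner norm_conj)
  have "hinner (gram_op \<phi> *v x) y = (\<Sum>i\<in>UNIV. \<Sum>j\<in>UNIV. gram_op \<phi> $ i $ j * x $ j * conj (y $ i))"
    by (simp add: hinner_def matrix_vector_mult_def sum_distrib_right)
  also have "\<dots> = (\<Sum>j\<in>UNIV. \<Sum>i\<in>UNIV. gram_op \<phi> $ i $ j * x $ j * conj (y $ i))"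
    by (rule sum.swap)
  also have "\<dots> = hinner x (gram_op \<phi> *v y)"
    unfolding hinner_def matrix_vector_mult_def
    by (simp add: gram_op_def conj_sum conj_mult sum_distrib_left sym mult_ac
        del: of_real_power)
  finally show ?thesis .
qed

text \<open>
  With \<open>b = G c\<close>, each coefficient of \<open>b\<close> in the eigenbasis is \<open>l i\<close> times that of \<open>c\<close>, so the
  sum represents \<open>\<langle>b, c\<rangle>\<close>. An eigenvalue 0 is harmless: the corresponding coefficient of \<open>b\<close>
  vanishes and the quotient by 0 is 0.
\<close>

lemma eigenbasis_quadratic_form:
  fixes \<phi> :: "'m::finite \<Rightarrow> 'a::rc_field ^ 'n::finite"
  assumes on: "orthonormal_basis e" and eig: "\<forall>i. gram_op \<phi> *v e i = l i *\<^sub>R e i"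
  shows "of_real (\<Sum>i\<in>UNIV. (norm (hinner (gram_op \<phi> *v c) (e i)))\<^sup>2 / l i) =
    hinner (gram_op \<phi> *v c) c"
proof -
  have coeff: "hinner (gram_op \<phi> *v c) (e i) = of_real (l i) * hinner c (e i)" for i
  proof -
    have "hinner (gram_op \<phi> *v c) (e i) = hinner c (l i *\<^sub>R e i)"
      using eig by (simp add: hinner_gram_op_selfadjoint)
    also have "\<dots> = l i *\<^sub>R hinner c (e i)"
      by (simp add: hinner_def conj_scaleR scaleR_sum_right)
    finally show ?thesis
      by (simp only: scaleR_conv_of_real)
  qed
  have "(norm (hinner (gram_op \<phi> *v c) (e i)))\<^sup>2 / l i = l i * (norm (hinner c (e i)))\<^sup>2" for i
    by (simp add: coeff norm_mult power_mult_distrib power2_eq_square[of "l i"])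
  then have "of_real (\<Sum>i\<in>UNIV. (norm (hinner (gram_op \<phi> *v c) (e i)))\<^sup>2 / l i) =
      (\<Sum>i\<in>UNIV. of_real (l i) * of_real ((norm (hinner c (e i)))\<^sup>2) :: 'a)"
    by (simp only: of_real_sum of_real_mult)
  also have "\<dots> = (\<Sum>i\<in>UNIV. hinner (gram_op \<phi> *v c) (e i) * conj (hinner c (e i)))"
    by (simp only: coeff mult.assoc mult_conj_of_real)
  also have "\<dots> = hinner (gram_op \<phi> *v c) c"
    by (rule parseval[OF on, symmetric])
  finally show ?thesis .
qed

text \<open>
  The quadratic form in \<open>mu4\<close> measures the squared norm of the projection \<open>p\<close> of \<open>outer \<psi>\<close> to the
  span of the outer products of the frame; it is 1 exactly when nothing is lost by projecting.
\<close>

lemma analysis_op_mem_mu4_iff: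
  fixes \<phi> :: "'m::finite \<Rightarrow> 'a::rc_field ^ 'n::finite"
  assumes on: "orthonormal_basis e" and eig: "\<forall>i. gram_op \<phi> *v e i = l i *\<^sub>R e i"
    and unit: "norm \<psi> = 1"
  shows "analysis_op \<phi> \<psi> \<in> mu4 e l \<longleftrightarrow> outer \<psi> \<in> span (range (\<lambda>i. outer (\<phi> i)))"
proof -
  obtain p r where p: "p \<in> span (range (\<lambda>i. outer (\<phi> i)))"
    and r: "\<And>w. w \<in> span (range (\<lambda>i. outer (\<phi> i))) \<Longrightarrow> orthogonal r w"
    and pr: "outer \<psi> = p + r"
    using orthogonal_subspace_decomp_exists[of "range (\<lambda>i. outer (\<phi> i))" "outer \<psi>"] by metis
  obtain c where c: "p = (\<Sum>i\<in>UNIV. c i *\<^sub>R outer (\<phi> i))"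
    using p unfolding span_range_eq_sums by blast
  define b where "b i = (norm (hinner \<psi> (\<phi> i)))\<^sup>2" for i
  define C :: "'a ^ 'm" where "C = (\<chi> i. of_real (c i))"
  have b_inner: "b i = inner p (outer (\<phi> i))" for i
  proof -
    have "inner r (outer (\<phi> i)) = 0"
      using r[of "outer (\<phi> i)"] by (simp add: orthogonal_def span_base)
    then show ?thesis
      unfolding b_def inner_outer[symmetric] pr by (simp add: inner_add_left)
  qed
  have "(\<Sum>j\<in>UNIV. (norm (hinner (\<phi> i) (\<phi> j)))\<^sup>2 * c j) = b i" for i
    unfolding b_inner c
    by (simp add: inner_sum_left inner_sum_right inner_outer[symmetric] inner_commute mult.commute)
  then have normal: "gram_op \<phi> *v C = (\<chi> i. of_real (b i))"
    unfolding matrix_vector_mult_def gram_op_def C_def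
    by (simp add: vec_eq_iff flip: of_real_mult of_real_sum of_real_power)
  have T: "(\<chi> k. analysis_op \<phi> \<psi> $ k * conj (analysis_op \<phi> \<psi> $ k)) = gram_op \<phi> *v C"
    by (simp add: normal vec_eq_iff analysis_op_def mult_conj_of_real b_def del: of_real_power)
  have "hinner (gram_op \<phi> *v C) C = of_real (\<Sum>i\<in>UNIV. b i * c i)"
    unfolding normal by (simp add: hinner_def C_def)
  also have "(\<Sum>i\<in>UNIV. b i * c i) = inner p p"
    unfolding b_inner by (subst (3) c) (simp add: inner_sum_right mult.commute)
  finally have "(of_real (\<Sum>i\<in>UNIV. (norm (hinner (gram_op \<phi> *v C) (e i)))\<^sup>2 / l i) :: 'a) =
      of_real (inner p p)"
    by (simp only: eigenbasis_quadratic_form[OF on eig])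
  then have form: "(\<Sum>i\<in>UNIV. (norm (hinner (gram_op \<phi> *v C) (e i)))\<^sup>2 / l i) = inner p p"
    unfolding of_real_eq_iff .
  have "inner (outer \<psi>) (outer \<psi>) = 1"
    by (simp add: inner_outer hinner_self unit)
  moreover have "inner r p = 0"
    using r[OF p] by (simp add: orthogonal_def)
  ultimately have "inner p p = 1 - inner r r"
    by (simp add: pr inner_add inner_commute)
  then have "analysis_op \<phi> \<psi> \<in> mu4 e l \<longleftrightarrow> r = 0"
    unfolding mu4_def by (simp add: T form)
  also have "r = 0 \<longleftrightarrow> outer \<psi> \<in> span (range (\<lambda>i. outer (\<phi> i)))"
  proof
    assume "r = 0"
    then show "outer \<psi> \<in> span (range (\<lambda>i. outer (\<phi> i)))" using p pr by simp
  next
    assume "outer \<psi> \<in> span (range (\<lambda>i. outer (\<phi> i)))"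
    then have "outer \<psi> - p \<in> span (range (\<lambda>i. outer (\<phi> i)))" using p by (rule span_diff)
    then have "orthogonal r r" using r pr by simp
    then show "r = 0" by (simp add: orthogonal_self)
  qed
  finally show ?thesis .
qed

section \<open>The set of dependent extensions\<close>

theorem theorem10p5:
  fixes \<phi> :: "'m::finite \<Rightarrow> 'a::rc_field ^ 'n::finite"
    and e :: "'m \<Rightarrow> 'a ^ 'm"
    and l :: "'m \<Rightarrow> real"
  assumes "unit_norm_frame \<phi>"
    and "CARD('m) < dim (self_adjoint_matrices :: ('a ^ 'n ^ 'n) set)"
    and "\<not> dependent_family (\<lambda>i. outer (\<phi> i))"
    and "orthonormal_basis e"
    and "\<forall>i. gram_op \<phi> *v e i = l i *\<^sub>R e i"
  shows "{\<psi> \<in> sphere 0 1. dependent_family (\<lambda>i. outer (case_option \<psi> \<phi> i))} =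
           inv_into (sphere 0 1) (analysis_op \<phi>) ` (mu2 \<phi> \<inter> mu4 e l) \<and>
         compact {\<psi> \<in> sphere 0 1. dependent_family (\<lambda>i. outer (case_option \<psi> \<phi> i))}"
    (is "?D = _ \<and> _")
proof
  let ?V = "span (range (\<lambda>i. outer (\<phi> i)))"
  have "(\<lambda>i. outer (case_option \<psi> \<phi> i)) = case_option (outer \<psi>) (\<lambda>i. outer (\<phi> i))" for \<psi>
    by (auto split: option.split)
  then have D: "?D = {\<psi> \<in> sphere 0 1. outer \<psi> \<in> ?V}"
    by (simp add: dependent_family_case_option_iff[OF assms(3)])
  have inj: "inj_on (analysis_op \<phi>) (sphere 0 1)"
    using inj_analysis_op[OF assms(1)] by (rule inj_on_subset) simp
  have "mu2 \<phi> \<inter> mu4 e l = analysis_op \<phi> ` ?D"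
    unfolding D mu2_def by (auto simp: analysis_op_mem_mu4_iff[OF assms(4,5)])
  moreover have "inv_into (sphere 0 1) (analysis_op \<phi>) ` analysis_op \<phi> ` ?D = ?D"
    by (rule inv_into_image_cancel[OF inj]) blast
  ultimately show "?D = inv_into (sphere 0 1) (analysis_op \<phi>) ` (mu2 \<phi> \<inter> mu4 e l)"
    by (simp only:)
  have "closed (sphere 0 1 \<inter> outer -` ?V)"
    by (intro continuous_closed_preimage continuous_on_outer closed_sphere closed_span)
  then have "closed ?D"
    unfolding D by (simp add: vimage_def Int_def)
  moreover have "bounded ?D"
    by (rule bounded_subset[OF bounded_sphere[of 0 1]]) blast
  ultimately show "compact ?D"
    by (simp add: compact_eq_bounded_closed)
qed

end
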